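(* There is a choice of a partially observable Markov chain $M=(\Omega,P,O)$ and a pair of states $a,b\in\Omega$ such that, for some $c=c(|\Omega|)>0$ depending only on $|\Omega|$, $$\mathrm{NAQC}_M(a,b)\;\ge\; c\cdot \mathrm{AQC}_M(a,b)^{(1-o(1))|\Omega|}.$$ This holds for infinitely many choices of $|\Omega|$ and of the query complexities.
   Context: A partially observable (p.o.) Markov chain $M=(\Omega,P,O)$ consists of a finite state space $\Omega$, transition probabilities $P$ (from a state $y$ the next state is drawn from the distribution $P(\cdot\mid y)$), and a deterministic observation function $O:\Omega\to\Sigma$. A rewinding strategy is a (possibly randomized) function $A:\Sigma^*\to\mathbb{Z}_{\ge 0}$. Starting from an initial state $X_0$, for every $t\ge 0$ set $Z_t=O(X_t)$ and draw $X_{t+1}\sim P(\cdot\mid X_{t'})$, where $t'=\max\{0,\,t-A(Z_0,\dots,Z_t)\}$, independently of everything else given $X_{t'}$; each such draw is a query. The states $X_t$ are hidden; only $Z_0,Z_1,\dots$ are observed. A rewinding strategy is non-adaptive if $A(Z_0,\dots,Z_t)$ depends only on $t$. For a strategy $A$ and states $a,b$, let $Z^a_0,Z^a_1,\dots$ (resp. $Z^b_0,\dots$) be the observations when $X_0=a$ (resp. $X_0=b$). $\mathrm{QC}^A_M(a,b)$ is the minimum $T$ such that the total variation distance between $(Z^a_0,\dots,Z^a_T)$ and $(Z^b_0,\dots,Z^b_T)$ is at least $1/3$. Then $\mathrm{AQC}_M(a,b)=\min_A \mathrm{QC}^A_M(a,b)$ over all rewinding strategies, and $\mathrm{NAQC}_M(a,b)=\min_A\mathrm{QC}^A_M(a,b)$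 over non-adaptive rewinding strategies. *)

theory Defs
  imports "HOL-Probability.Probability"
begin

record ('s, 'o) po_chain =
  states :: "'s set"
  kernel :: "'s \<Rightarrow> 's pmf"
  observe :: "'s \<Rightarrow> 'o"

definition po_markov_chain :: "('s, 'o) po_chain \<Rightarrow> bool" where
  "po_markov_chain M \<longleftrightarrow>
     finite (states M) \<and> (\<forall>y\<in>states M. set_pmf (kernel M y) \<subseteq> states M)"

text \<open>
  A randomized strategy is a random function, given by its law: the function is drawn once, before
  the process starts, independently of the chain.  Since the values on distinct histories may be
  correlated or independent, this covers both a shared random seed and fresh coins at each step.
  Discreteness of the law costs nothing, as the observations up to time \<open>T\<close> depend only on the values
  on the finitely many possible histories of length at most \<open>T\<close>.
\<close>
type_synonym 'o rewinding_strategy = "('o list \<Rightarrow> nat) pmf"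

definition nonadaptive :: "'o rewinding_strategy \<Rightarrow> bool" where
  "nonadaptive A \<longleftrightarrow>
     (\<forall>f\<in>set_pmf A. \<forall>zs zs'. length zs = length zs' \<longrightarrow> f zs = f zs')"

text \<open>
  The law of \<open>[X\<^sub>0, \<dots>, X\<^sub>t]\<close> for \<open>X\<^sub>0 = x\<close>, given that the drawn strategy is \<open>f\<close>.
  The truncated subtraction of naturals is \<open>max {0, t - f (Z\<^sub>0, \<dots>, Z\<^sub>t)}\<close>.
\<close>
primrec state_path ::
  "('s, 'o) po_chain \<Rightarrow> ('o list \<Rightarrow> nat) \<Rightarrow> 's \<Rightarrow> nat \<Rightarrow> 's list pmf" where
  "state_path M f x 0 = return_pmf [x]"
| "state_path M f x (Suc t) =
     bind_pmf (state_path M f x t)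
       (\<lambda>xs. map_pmf (\<lambda>y. xs @ [y])
                (kernel M (xs ! (t - f (map (observe M) xs)))))"

definition observations ::
  "('s, 'o) po_chain \<Rightarrow> 'o rewinding_strategy \<Rightarrow> 's \<Rightarrow> nat \<Rightarrow> 'o list pmf" where
  "observations M A x T =
     bind_pmf A (\<lambda>f. map_pmf (map (observe M)) (state_path M f x T))"

definition tv_dist :: "'a pmf \<Rightarrow> 'a pmf \<Rightarrow> real" where
  "tv_dist p q = (SUP S. \<bar>measure_pmf.prob p S - measure_pmf.prob q S\<bar>)"

text \<open>
  Query complexities are extended naturals: the infimum is \<open>\<infinity>\<close> if no \<open>T\<close> qualifies, and is an
  attained minimum otherwise.
\<close>
definition QC ::
  "('s, 'o) po_chain \<Rightarrow> 'o rewinding_strategy \<Rightarrow> 's \<Rightarrow> 's \<Rightarrow> enat" where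
  "QC M A a b =
     (INF T\<in>{T. tv_dist (observations M A a T) (observations M A b T) \<ge> 1 / 3}. enat T)"

definition AQC :: "('s, 'o) po_chain \<Rightarrow> 's \<Rightarrow> 's \<Rightarrow> enat" where
  "AQC M a b = (INF A. QC M A a b)"

definition NAQC :: "('s, 'o) po_chain \<Rightarrow> 's \<Rightarrow> 's \<Rightarrow> enat" where
  "NAQC M a b = (INF A\<in>{A. nonadaptive A}. QC M A a b)"

end

theory Submission imports Defs begin

text \<open>
  The chain counts down: from \<open>y\<close> it moves to \<open>y - 1\<close> with probability \<open>p = 1/k\<close> and otherwise
  falls into the absorbing state 0, and only whether the state is 0 is observed.  The start states
  are \<open>m\<close> and \<open>m - 1\<close>, on \<open>n = m + 1\<close> states.  An adaptive strategy always rewinds to the latest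
  nonzero state \<open>v\<close>.  Its potential \<open>2\<^sup>v\<^sup>-\<^sup>1 - 1\<close> shrinks on average by the factor \<open>1 - p/2\<close> per query,
  so after \<open>O(m k)\<close> queries it has probably seen as many nonzero states as there are from its start,
  which tells \<open>m\<close> from \<open>m - 1\<close>.  For a non-adaptive strategy, subtracting 1 from all states couples
  the process started at \<open>m\<close> with the one started at \<open>m - 1\<close>, and the observations differ only if
  the former visits state 1.  At any fixed time this has probability at most \<open>p\<^sup>m\<^sup>-\<^sup>1\<close>, so about
  \<open>k\<^sup>m\<^sup>-\<^sup>1\<close> queries are needed.
\<close>

subsection \<open>Expectations and total variation for discrete distributions\<close>

lemma expectation_bind_pmf_finite:
  fixes h :: "'b \<Rightarrow> real"
  assumes "finite (set_pmf q)" and "\<And>x. finite (set_pmf (f x))"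
  shows "measure_pmf.expectation (bind_pmf q f) h
       = measure_pmf.expectation q (\<lambda>x. measure_pmf.expectation (f x) h)"
  using assms
  by (subst pmf_expectation_bind[where A = "set_pmf q"])
     (auto simp: integral_measure_pmf[where A = "set_pmf q"])

lemma expectation_pmf_mono:
  fixes f g :: "'a \<Rightarrow> real"
  assumes "finite (set_pmf q)" and "\<And>x. x \<in> set_pmf q \<Longrightarrow> f x \<le> g x"
  shows "measure_pmf.expectation q f \<le> measure_pmf.expectation q g"
  using assms by (intro integral_mono_AE integrable_measure_pmf_finite) (auto simp: AE_measure_pmf_iff)

lemma prob_eq_expectation: "measure_pmf.prob q S = measure_pmf.expectation q (\<lambda>x. of_bool (x \<in> S))"
proof -
  have "(\<lambda>x. of_bool (x \<in> S)) = (indicator S :: _ \<Rightarrow> real)" by (auto simp: fun_eq_iff)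
  then show ?thesis by simp
qed

lemma prob_bind_pmf:
  "measure_pmf.prob (bind_pmf q f) S = measure_pmf.expectation q (\<lambda>x. measure_pmf.prob (f x) S)"
  unfolding measure_pmf_bind
  by (rule measure_pmf.measure_bind[where N = "count_space UNIV"]) (auto simp: measure_subprob)

lemma integrable_prob_pmf:
  "integrable (measure_pmf q) (\<lambda>x. measure_pmf.prob (f x) S)"
  by (rule measure_pmf.integrable_const_bound[where B = 1]) auto

lemma tv_dist_leI:
  assumes "\<And>S. \<bar>measure_pmf.prob p S - measure_pmf.prob q S\<bar> \<le> d"
  shows "tv_dist p q \<le> d"
  unfolding tv_dist_def using assms by (intro cSUP_least) auto

lemma prob_diff_le_tv_dist: "measure_pmf.prob p S - measure_pmf.prob q S \<le> tv_dist p q"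
proof -
  have "\<bar>measure_pmf.prob p S - measure_pmf.prob q S\<bar> \<le> 1" for S
    using measure_pmf.prob_le_1[of p S] measure_pmf.prob_le_1[of q S]
      measure_nonneg[of "measure_pmf p" S] measure_nonneg[of "measure_pmf q" S]
    by linarith
  then have "bdd_above (range (\<lambda>S. \<bar>measure_pmf.prob p S - measure_pmf.prob q S\<bar>))"
    by (intro bdd_aboveI[where M = 1]) auto
  then have "\<bar>measure_pmf.prob p S - measure_pmf.prob q S\<bar> \<le> tv_dist p q"
    unfolding tv_dist_def by (intro cSUP_upper) auto
  then show ?thesis by linarith
qed

text \<open>Conditioning on the drawn function, which has the same law for both starts, extends a
  bound for each fixed function to randomized strategies.\<close>

lemma tv_dist_bind_pmf_leI:
  assumes "\<And>x S. x \<in> set_pmf q \<Longrightarrow> \<bar>measure_pmf.prob (f x) S - measure_pmf.prob (g x) S\<bar> \<le> d"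
  shows "tv_dist (bind_pmf q f) (bind_pmf q g) \<le> d"
proof (rule tv_dist_leI)
  fix S
  let ?D = "\<lambda>x. measure_pmf.prob (f x) S - measure_pmf.prob (g x) S"
  have int: "integrable (measure_pmf q) ?D"
    by (intro Bochner_Integration.integrable_diff integrable_prob_pmf)
  have "measure_pmf.prob (bind_pmf q f) S - measure_pmf.prob (bind_pmf q g) S
      = measure_pmf.expectation q ?D"
    by (simp add: prob_bind_pmf Bochner_Integration.integral_diff integrable_prob_pmf)
  moreover have "\<bar>measure_pmf.expectation q ?D\<bar> \<le> measure_pmf.expectation q (\<lambda>x. \<bar>?D x\<bar>)"
    by (rule integral_abs_bound)
  moreover have "\<dots> \<le> measure_pmf.expectation q (\<lambda>x. d)"
    using assms int by (intro integral_mono_AE) (auto simp: AE_measure_pmf_iff)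
  moreover have "\<dots> = d" by simp
  ultimately show
    "\<bar>measure_pmf.prob (bind_pmf q f) S - measure_pmf.prob (bind_pmf q g) S\<bar> \<le> d" by linarith
qed

text \<open>An event containing \<open>z\<close> has probability in \<open>[1 - d, 1]\<close> under
  both laws, and one avoiding \<open>z\<close> has probability in \<open>[0, d]\<close>; either
  interval has length \<open>d\<close>.\<close>

lemma prob_diff_le_if_common_atom:
  assumes "measure_pmf.prob p {z} \<ge> 1 - d" and "measure_pmf.prob q {z} \<ge> 1 - d"
  shows "\<bar>measure_pmf.prob p S - measure_pmf.prob q S\<bar> \<le> d"
proof -
  have bounds: "(if z \<in> S then 1 - d else 0) \<le> measure_pmf.prob r S"
    "measure_pmf.prob r S \<le> (if z \<in> S then 1 else d)" if "measure_pmf.prob r {z} \<ge> 1 - d" for r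
  proof -
    show "(if z \<in> S then 1 - d else 0) \<le> measure_pmf.prob r S"
      using that measure_pmf.finite_measure_mono[of "{z}" S r] by auto
    show "measure_pmf.prob r S \<le> (if z \<in> S then 1 else d)"
    proof (cases "z \<in> S")
      case False
      then have "measure_pmf.prob r S \<le> measure_pmf.prob r (UNIV - {z})"
        by (intro measure_pmf.finite_measure_mono) auto
      also have "\<dots> = 1 - measure_pmf.prob r {z}"
        using measure_pmf.prob_compl[of "{z}" r] by simp
      finally show ?thesis using that False by auto
    qed auto
  qed
  show ?thesis
    using bounds[OF assms(1)] bounds[OF assms(2)]
      measure_nonneg[of "measure_pmf p" S] measure_nonneg[of "measure_pmf q" S]
    by (cases "z \<in> S") (simp_all only: if_True if_False abs_le_iff, linarith+)
qed

subsection \<open>The countdown chain\<close>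

text \<open>State 0 is absorbing because \<open>0 - 1 = 0\<close> in the naturals. Numeric
  observations make their sum count the nonzero states.\<close>

definition countdown :: "nat \<Rightarrow> real \<Rightarrow> (nat, nat) po_chain" where
  "countdown m p =
     \<lparr>states = {..m}, kernel = (\<lambda>y. map_pmf (\<lambda>s. if s then y - 1 else 0) (bernoulli_pmf p)),
      observe = (\<lambda>y. min y 1)\<rparr>"

lemma countdown_simps [simp]:
  "states (countdown m p) = {..m}"
  "kernel (countdown m p) y = map_pmf (\<lambda>s. if s then y - 1 else 0) (bernoulli_pmf p)"
  "observe (countdown m p) = (\<lambda>y. min y 1)"
  by (simp_all add: countdown_def)

lemma po_markov_chain_countdown: "po_markov_chain (countdown m p)"
  by (auto simp: po_markov_chain_def)

lemma length_state_path: "xs \<in> set_pmf (state_path M f x t) \<Longrightarrow> length xs = Suc t"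
  by (induction t arbitrary: xs) auto

lemma finite_set_state_path:
  "finite (set_pmf (state_path (countdown m p) f x t))"
  by (induction t) auto

lemma expectation_state_path_Suc:
  fixes h :: "nat list \<Rightarrow> real"
  assumes "0 \<le> p" "p \<le> 1"
  shows "measure_pmf.expectation (state_path (countdown m p) f x (Suc t)) h
       = measure_pmf.expectation (state_path (countdown m p) f x t)
           (\<lambda>xs. p * h (xs @ [xs ! (t - f (map (\<lambda>y. min y 1) xs)) - 1]) + (1 - p) * h (xs @ [0]))"
  using assms
  by (simp, subst expectation_bind_pmf_finite) (auto simp: finite_set_state_path mult.commute)

subsection \<open>Adaptive strategies\<close>

lemma prob_fail_state_path:
  assumes "0 \<le> p" "p \<le> 1"
  shows "measure_pmf.prob (state_path (countdown m p) f x t) {x # replicate t 0} \<ge> (1 - p) ^ t"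
proof (induction t)
  case (Suc t)
  have "(1 - p) ^ Suc t
      \<le> (1 - p) * measure_pmf.prob (state_path (countdown m p) f x t) {x # replicate t 0}"
    using Suc assms by (simp add: mult_left_mono)
  also have "\<dots> = measure_pmf.expectation (state_path (countdown m p) f x t)
      (\<lambda>xs. (1 - p) * of_bool (xs \<in> {x # replicate t 0}))"
    by (simp add: prob_eq_expectation)
  also have "\<dots> \<le> measure_pmf.prob (state_path (countdown m p) f x (Suc t)) {x # replicate (Suc t) 0}"
    unfolding prob_eq_expectation expectation_state_path_Suc[OF assms]
    using assms
    by (intro expectation_pmf_mono) (auto simp: finite_set_state_path replicate_append_same)
  finally show ?case .
qed simp

text \<open>Wherever a query restarts, it returns state 0 with probability at least
  \<open>1 - p\<close>. So \<open>1 # replicate t 0\<close> is a common atom of mass at least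
  \<open>(1 - p) ^ t\<close>, which is at least \<open>1 - t * p\<close> by Bernoulli's
  inequality.\<close>

lemma tv_dist_countdown_le:
  assumes "0 \<le> p" "p \<le> 1" "x \<ge> 1" "y \<ge> 1"
  shows "tv_dist (observations (countdown m p) A x t) (observations (countdown m p) A y t) \<le> real t * p"
  unfolding observations_def
proof (rule tv_dist_bind_pmf_leI, rule prob_diff_le_if_common_atom)
  have "1 - real t * p \<le> (1 - p) ^ t"
    using Bernoulli_inequality[of "- p" t] assms by simp
  moreover have "(1 - p) ^ t \<le> measure_pmf.prob
      (map_pmf (map (observe (countdown m p))) (state_path (countdown m p) f x t)) {1 # replicate t 0}"
    if "x \<ge> 1" for f x
  proof -
    have "(1 - p) ^ t \<le> measure_pmf.prob (state_path (countdown m p) f x t) {x # replicate t 0}"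
      using assms by (intro prob_fail_state_path) auto
    also have "\<dots> \<le> measure_pmf.prob (state_path (countdown m p) f x t)
        (map (observe (countdown m p)) -` {1 # replicate t 0})"
      using that by (intro measure_pmf.finite_measure_mono) (auto simp: map_replicate)
    finally show ?thesis by simp
  qed
  ultimately show
    "1 - real t * p \<le> measure_pmf.prob
      (map_pmf (map (observe (countdown m p))) (state_path (countdown m p) f x t)) {1 # replicate t 0}"
    "1 - real t * p \<le> measure_pmf.prob
      (map_pmf (map (observe (countdown m p))) (state_path (countdown m p) f y t)) {1 # replicate t 0}"
    for f using assms by (meson order_trans)+
qed

section \<open>The strategy that rewinds to the latest nonzero state\<close>

definition trailing_zeros :: "nat list \<Rightarrow> nat" where
  "trailing_zeros zs = length (takeWhile (\<lambda>z. z = 0) (rev zs))"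

primrec last_nonzero :: "nat list \<Rightarrow> nat" where
  "last_nonzero [] = 0"
| "last_nonzero (x # xs) = (if last_nonzero xs = 0 then x else last_nonzero xs)"

lemma last_nonzero_snoc [simp]:
  "last_nonzero (xs @ [y]) = (if y = 0 then last_nonzero xs else y)"
  by (induction xs) auto

lemma trailing_zeros_simps [simp]:
  "trailing_zeros [] = 0"
  "trailing_zeros (zs @ [z]) = (if z = 0 then Suc (trailing_zeros zs) else 0)"
  by (simp_all add: trailing_zeros_def)

text \<open>The zeros observed since the latest nonzero state measure the distance back to it, so
  the strategy can reach that state without knowing its value. The bound on the count says that the
  truncated subtraction is exact.\<close>

lemma nth_trailing_zeros:
  assumes "last_nonzero xs \<noteq> 0"
  shows "xs ! (length xs - 1 - trailing_zeros (map (\<lambda>y. min y 1) xs)) = last_nonzero xs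
       \<and> trailing_zeros (map (\<lambda>y. min y 1) xs) < length xs"
  using assms
proof (induction xs rule: rev_induct)
  case (snoc y xs)
  then show ?case
    by (cases "y = 0") (auto simp: nth_append)
qed auto

text \<open>A nonzero draw lowers the latest nonzero state by one and raises the number of nonzero
  observations by one; a zero draw changes neither. From state 1 every draw is zero, so the latest
  nonzero state never drops below 1.\<close>

lemma state_path_invariant:
  assumes "xs \<in> set_pmf (state_path (countdown m p) trailing_zeros x t)" and "x \<ge> 1"
  shows "last_nonzero xs \<ge> 1
       \<and> sum_list (map (\<lambda>y. min y 1) xs) + last_nonzero xs = x + 1"
  using assms(1)
proof (induction t arbitrary: xs)
  case 0
  then show ?case using assms(2) by auto
next
  case (Suc t)
  from Suc.prems obtain ys y where ys: "ys \<in> set_pmf (state_path (countdown m p) trailing_zeros x t)"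
    and xs: "xs = ys @ [y]"
    and y: "y = 0 \<or> y = ys ! (t - trailing_zeros (map (\<lambda>y. min y 1) ys)) - 1"
    by (auto split: if_splits)
  have "ys ! (t - trailing_zeros (map (\<lambda>y. min y 1) ys)) = last_nonzero ys"
    using nth_trailing_zeros[of ys] Suc.IH[OF ys] length_state_path[OF ys] by auto
  then show ?case using Suc.IH[OF ys] y by (auto simp: xs)
qed

text \<open>With \<open>D = 2 ^ (v - 1) - 1\<close>, a success takes \<open>D\<close> to
  \<open>(D - 1) / 2\<close>, at most half, if \<open>v \<ge> 2\<close>. The \<open>if\<close>
  covers \<open>v = 1\<close>: there a success lands on 0, the latest nonzero state stays 1 and
  \<open>D\<close> stays 0.\<close>

lemma potential_step:
  fixes p :: real
  assumes "0 \<le> p" "v \<ge> 1"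
  shows "p * (2 ^ ((if v - 1 = 0 then v else v - 1) - 1) - 1) + (1 - p) * (2 ^ (v - 1) - 1)
       \<le> (1 - p / 2) * (2 ^ (v - 1) - 1)"
proof (cases "v = 1")
  case False
  then obtain j where "v = Suc (Suc j)"
    using assms(2) by (metis One_nat_def Suc_le_D not0_implies_Suc)
  then show ?thesis using assms by (simp add: algebra_simps)
qed simp

lemma expectation_potential:
  assumes "0 \<le> p" "p \<le> 1" "x \<ge> 1"
  shows "measure_pmf.expectation (state_path (countdown m p) trailing_zeros x t)
           (\<lambda>xs. 2 ^ (last_nonzero xs - 1) - 1) \<le> (1 - p / 2) ^ t * (2 ^ (x - 1) - 1)"
proof (induction t)
  case (Suc t)
  let ?E = "measure_pmf.expectation (state_path (countdown m p) trailing_zeros x t)"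
  have "measure_pmf.expectation (state_path (countdown m p) trailing_zeros x (Suc t))
          (\<lambda>xs. 2 ^ (last_nonzero xs - 1) - 1)
      \<le> ?E (\<lambda>xs. (1 - p / 2) * (2 ^ (last_nonzero xs - 1) - 1))"
    unfolding expectation_state_path_Suc[OF assms(1,2)]
  proof (rule expectation_pmf_mono[OF finite_set_state_path])
    fix xs assume xs: "xs \<in> set_pmf (state_path (countdown m p) trailing_zeros x t)"
    have "xs ! (t - trailing_zeros (map (\<lambda>y. min y 1) xs)) = last_nonzero xs"
      using nth_trailing_zeros[of xs] state_path_invariant[OF xs assms(3)] length_state_path[OF xs]
      by auto
    then show "p * (2 ^ (last_nonzero (xs @ [xs ! (t - trailing_zeros (map (\<lambda>y. min y 1) xs)) - 1]) - 1) - 1)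
        + (1 - p) * (2 ^ (last_nonzero (xs @ [0]) - 1) - 1)
        \<le> (1 - p / 2) * (2 ^ (last_nonzero xs - 1) - 1)"
      using potential_step[OF assms(1), of "last_nonzero xs"] state_path_invariant[OF xs assms(3)]
      by (simp only: last_nonzero_snoc simp_thms if_True)
  qed
  also have "\<dots> \<le> (1 - p / 2) ^ Suc t * (2 ^ (x - 1) - 1)"
    using mult_left_mono[OF Suc, of "1 - p / 2"] assms by (simp add: mult.assoc)
  finally show ?case .
qed simp

text \<open>The distinguishing event is that at least \<open>m\<close> nonzero states are observed:
  it is impossible from \<open>m - 1\<close> and has probability at least 1/2 from
  \<open>m\<close>.\<close>

lemma tv_dist_trailing_zeros_ge:
  assumes "k \<ge> 1" "m \<ge> 2"
  defines "M \<equiv> countdown m (1 / real k)" and "A \<equiv> return_pmf trailing_zeros"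
  shows "tv_dist (observations M A m (2 * m * k)) (observations M A (m - 1) (2 * m * k)) \<ge> 1 / 3"
proof -
  \<comment> \<open>Each block of \<open>2 * k\<close> queries shrinks the expected potential at
    least by half; \<open>m\<close> blocks bring the initial value, below
    \<open>2 ^ (m - 1)\<close>, down to at most 1/2.\<close>
  define T where "T = 2 * m * k"
  define p where "p = 1 / real k"
  let ?P = "\<lambda>x. state_path M trailing_zeros x T"
  let ?S = "{zs. sum_list zs \<ge> m}"
  have p: "0 \<le> p" "p \<le> 1" using assms by (auto simp: p_def)
  have M: "M = countdown m p" by (simp add: M_def p_def)
  have prob: "measure_pmf.prob (observations M A x T) ?S
      = measure_pmf.expectation (?P x) (\<lambda>xs. of_bool (sum_list (map (\<lambda>y. min y 1) xs) \<ge> m))" for x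
    by (simp add: observations_def A_def bind_return_pmf M prob_eq_expectation)
  have "measure_pmf.prob (observations M A (m - 1) T) ?S \<le> measure_pmf.expectation (?P (m - 1)) (\<lambda>xs. 0)"
    unfolding prob
  proof (rule expectation_pmf_mono)
    fix xs assume "xs \<in> set_pmf (?P (m - 1))"
    then have "last_nonzero xs \<ge> 1 \<and> sum_list (map (\<lambda>y. min y 1) xs) + last_nonzero xs = m - 1 + 1"
      unfolding M using assms(2) by (intro state_path_invariant) auto
    then show "of_bool (sum_list (map (\<lambda>y. min y 1) xs) \<ge> m) \<le> (0 :: real)"
      using assms(2) by simp
  qed (simp add: M finite_set_state_path)
  then have low: "measure_pmf.prob (observations M A (m - 1) T) ?S \<le> 0" by simp
  let ?D = "\<lambda>xs. 2 ^ (last_nonzero xs - 1) - 1 :: real"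
  have "1 - measure_pmf.expectation (?P m) ?D = measure_pmf.expectation (?P m) (\<lambda>xs. 1 - ?D xs)"
    by (subst (2) Bochner_Integration.integral_diff)
       (auto intro!: integrable_measure_pmf_finite simp: M finite_set_state_path)
  also have "\<dots> \<le> measure_pmf.prob (observations M A m T) ?S"
    unfolding prob
  proof (rule expectation_pmf_mono)
    fix xs assume "xs \<in> set_pmf (?P m)"
    then have inv: "last_nonzero xs \<ge> 1" "sum_list (map (\<lambda>y. min y 1) xs) + last_nonzero xs = m + 1"
      using state_path_invariant[of xs m p m T] assms(2) by (simp_all add: M)
    \<comment> \<open>Markov's inequality pathwise: the potential is 0 if the latest nonzero state
      is 1, which means \<open>m\<close> nonzero observations, and at least 1 otherwise.\<close>
    show "1 - ?D xs \<le> (of_bool (sum_list (map (\<lambda>y. min y 1) xs) \<ge> m) :: real)"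
    proof (cases "last_nonzero xs = 1")
      case False
      then have "(2 :: real) ^ 1 \<le> 2 ^ (last_nonzero xs - 1)"
        using inv by (intro power_increasing) auto
      then show ?thesis by simp
    qed (use inv in simp)
  qed (simp add: M finite_set_state_path)
  finally have high: "1 - measure_pmf.expectation (?P m) ?D
      \<le> measure_pmf.prob (observations M A m T) ?S" .
  have "measure_pmf.expectation (?P m) ?D
      \<le> (1 - p / 2) ^ T * (2 ^ (m - 1) - 1)"
    unfolding M using p assms(2) by (intro expectation_potential) auto
  also have "\<dots> \<le> (1 / 2) ^ m * 2 ^ (m - 1)"
  proof (rule mult_mono)
    have "(1 - p / 2) ^ (2 * k) \<le> exp (- p / 2) ^ (2 * k)"
      using p exp_ge_add_one_self[of "- p / 2"] by (intro power_mono) auto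
    also have "\<dots> = exp (- 1)"
      using assms(1) by (simp add: p_def flip: exp_of_nat_mult)
    also have "\<dots> \<le> 1 / 2"
      using exp_ge_add_one_self[of 1] by (simp add: exp_minus field_simps)
    finally have "((1 - p / 2) ^ (2 * k)) ^ m \<le> (1 / 2) ^ m"
      using p by (intro power_mono) auto
    then show "(1 - p / 2) ^ T \<le> (1 / 2) ^ m"
      by (simp add: T_def flip: power_mult) (simp add: mult.commute mult.left_commute)
  qed auto
  also have "\<dots> = 1 / 2"
    using assms(2) by (cases m) (auto simp: power_one_over)
  finally have "1 / 2 \<le> measure_pmf.prob (observations M A m T) ?S" using high by linarith
  then show ?thesis
    using low prob_diff_le_tv_dist[of "observations M A m T" ?S "observations M A (m - 1) T"]
    unfolding T_def by linarith
qed

subsection \<open>Non-adaptive strategies\<close>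

text \<open>The rewind times do not depend on the observations, and truncated decrement commutes
  with both outcomes of the kernel, so decrementing a whole path is a coupling.\<close>

lemma state_path_countdown_pred:
  assumes "\<forall>zs zs'. length zs = length zs' \<longrightarrow> f zs = f zs'"
  shows "state_path (countdown m p) f (x - 1) t
       = map_pmf (map (\<lambda>y. y - 1)) (state_path (countdown m p) f x t)"
proof (induction t)
  case (Suc t)
  show ?case
    unfolding state_path.simps Suc map_bind_pmf bind_map_pmf
  proof (rule bind_pmf_cong[OF refl])
    fix xs assume xs: "xs \<in> set_pmf (state_path (countdown m p) f x t)"
    have "f (map (observe (countdown m p)) (map (\<lambda>y. y - 1) xs)) = f (map (observe (countdown m p)) xs)"
      by (intro assms[rule_format]) simp
    then show "map_pmf (\<lambda>y. map (\<lambda>y. y - 1) xs @ [y]) (kernel (countdown m p)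
          (map (\<lambda>y. y - 1) xs ! (t - f (map (observe (countdown m p)) (map (\<lambda>y. y - 1) xs)))))
        = map_pmf (map (\<lambda>y. y - 1)) (map_pmf (\<lambda>y. xs @ [y]) (kernel (countdown m p)
          (xs ! (t - f (map (observe (countdown m p)) xs)))))"
      using length_state_path[OF xs] by (auto simp: map_pmf_comp intro!: pmf.map_cong0)
  qed
qed simp

text \<open>Reaching \<open>y \<ge> 1\<close> takes a success from \<open>y + 1\<close> at the
  rewind time, which is fixed in advance. Writing \<open>p ^ m * (1 / p) ^ y\<close> for the power
  \<open>m - y\<close> avoids truncation when \<open>y > m\<close>, where the bound is at least
  1.\<close>

lemma state_path_marginal_le:
  assumes f: "\<forall>zs zs'. length zs = length zs' \<longrightarrow> f zs = f zs'" and p: "0 < p" "p \<le> 1"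
    and "j \<le> t" "y \<ge> 1"
  shows "measure_pmf.expectation (state_path (countdown m p) f m t) (\<lambda>xs. of_bool (xs ! j = y))
       \<le> p ^ m * (1 / p) ^ y"
  using \<open>j \<le> t\<close> \<open>y \<ge> 1\<close>
proof (induction t arbitrary: j y)
  case 0
  then show ?case using p by (auto simp: power_one_over)
next
  case (Suc t)
  let ?P = "state_path (countdown m p) f m t"
  have p': "0 \<le> p" "p \<le> 1" using p by auto
  show ?case
  proof (cases "j = Suc t")
    case False
    then have "j \<le> t" using Suc.prems by simp
    have "measure_pmf.expectation (state_path (countdown m p) f m (Suc t)) (\<lambda>xs. of_bool (xs ! j = y))
        \<le> measure_pmf.expectation ?P (\<lambda>xs. of_bool (xs ! j = y) :: real)"
      unfolding expectation_state_path_Suc[OF p']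
      using \<open>j \<le> t\<close>
      by (intro expectation_pmf_mono[OF finite_set_state_path])
         (auto simp: nth_append dest!: length_state_path)
    then show ?thesis using Suc.IH[OF \<open>j \<le> t\<close> \<open>y \<ge> 1\<close>] by linarith
  next
    case True
    \<comment> \<open>Any history of length \<open>t + 1\<close> serves here, since \<open>f\<close>
      depends on the length only.\<close>
    define i where "i = t - f (replicate (Suc t) 0)"
    have "measure_pmf.expectation (state_path (countdown m p) f m (Suc t)) (\<lambda>xs. of_bool (xs ! j = y))
        \<le> measure_pmf.expectation ?P (\<lambda>xs. p * of_bool (xs ! i = Suc y))"
      unfolding expectation_state_path_Suc[OF p']
    proof (rule expectation_pmf_mono[OF finite_set_state_path])
      fix xs assume "xs \<in> set_pmf ?P"
      then have len: "length xs = Suc t" by (rule length_state_path)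
      then have "f (map (\<lambda>y. min y 1) xs) = f (replicate (Suc t) 0)"
        by (intro f[rule_format]) simp
      then show "p * of_bool ((xs @ [xs ! (t - f (map (\<lambda>y. min y 1) xs)) - 1]) ! j = y)
          + (1 - p) * of_bool ((xs @ [0]) ! j = y) \<le> p * of_bool (xs ! i = Suc y)"
        using len True Suc.prems by (auto simp: nth_append i_def)
    qed
    also have "\<dots> = p * measure_pmf.expectation ?P (\<lambda>xs. of_bool (xs ! i = Suc y))" by simp
    also have "\<dots> \<le> p * (p ^ m * (1 / p) ^ Suc y)"
      using p Suc.prems by (intro mult_left_mono Suc.IH) (auto simp: i_def)
    also have "\<dots> = p ^ m * (1 / p) ^ y" using p by simp
    finally show ?thesis .
  qed
qed

lemma tv_dist_nonadaptive_le:
  assumes p: "0 < p" "p \<le> 1" and "m \<ge> 1" and A: "nonadaptive A"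
  shows "tv_dist (observations (countdown m p) A m t) (observations (countdown m p) A (m - 1) t)
       \<le> real (Suc t) * p ^ (m - 1)"
  unfolding observations_def
proof (rule tv_dist_bind_pmf_leI)
  fix f S assume "f \<in> set_pmf A"
  then have f: "\<forall>zs zs'. length zs = length zs' \<longrightarrow> f zs = f zs'"
    using A by (auto simp: nonadaptive_def)
  let ?P = "state_path (countdown m p) f m t"
  let ?E = "measure_pmf.expectation ?P"
  let ?O = "map (\<lambda>y :: nat. min y 1)"
  let ?a = "\<lambda>xs. of_bool (?O xs \<in> S) :: real"
  let ?b = "\<lambda>xs. of_bool (?O (map (\<lambda>y. y - 1) xs) \<in> S) :: real"
  have int: "integrable (measure_pmf ?P) h" for h :: "nat list \<Rightarrow> real"
    by (intro integrable_measure_pmf_finite finite_set_state_path)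
  have "measure_pmf.prob (map_pmf (map (observe (countdown m p))) ?P) S
      - measure_pmf.prob (map_pmf (map (observe (countdown m p))) (state_path (countdown m p) f (m - 1) t)) S
      = ?E (\<lambda>xs. ?a xs - ?b xs)"
    unfolding state_path_countdown_pred[OF f] prob_eq_expectation integral_map_pmf
    by (subst Bochner_Integration.integral_diff[OF int int]) simp
  moreover have "\<bar>?E (\<lambda>xs. ?a xs - ?b xs)\<bar> \<le> ?E (\<lambda>xs. \<bar>?a xs - ?b xs\<bar>)"
    by (rule integral_abs_bound)
  \<comment> \<open>Decrementing changes an observation only at state 1, so a union bound over the
    \<open>t + 1\<close> times applies.\<close>
  moreover have "\<dots> \<le> ?E (\<lambda>xs. \<Sum>j\<le>t. of_bool (xs ! j = 1))"
  proof (rule expectation_pmf_mono[OF finite_set_state_path])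
    fix xs assume "xs \<in> set_pmf ?P"
    then have len: "length xs = Suc t" by (rule length_state_path)
    show "\<bar>?a xs - ?b xs\<bar> \<le> (\<Sum>j\<le>t. of_bool (xs ! j = 1))"
    proof (cases "\<exists>j\<le>t. xs ! j = 1")
      case True
      then obtain j where "j \<le> t" "xs ! j = 1" by blast
      then have "of_bool (xs ! j = 1) \<le> (\<Sum>j\<le>t. of_bool (xs ! j = 1) :: real)"
        by (intro member_le_sum) auto
      then have "1 \<le> (\<Sum>j\<le>t. of_bool (xs ! j = 1) :: real)"
        using \<open>xs ! j = 1\<close> by simp
      moreover have "\<bar>?a xs - ?b xs\<bar> \<le> 1" by simp
      ultimately show ?thesis by linarith
    next
      case False
      then have "?O (map (\<lambda>y. y - 1) xs) = ?O xs"
        using len by (intro nth_equalityI) (auto simp: min_def less_Suc_eq_le Suc_le_eq)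
      then have "\<bar>?a xs - ?b xs\<bar> = 0" by (simp only: diff_self abs_zero)
      moreover have "0 \<le> (\<Sum>j\<le>t. of_bool (xs ! j = 1) :: real)" by (intro sum_nonneg) simp
      ultimately show ?thesis by linarith
    qed
  qed
  moreover have "\<dots> = (\<Sum>j\<le>t. ?E (\<lambda>xs. of_bool (xs ! j = 1)))"
    by (intro Bochner_Integration.integral_sum int)
  moreover have "\<dots> \<le> (\<Sum>j\<le>t. p ^ m * (1 / p) ^ 1)"
    using p by (intro sum_mono state_path_marginal_le[OF f]) auto
  moreover have "\<dots> = real (Suc t) * p ^ (m - 1)"
    using p \<open>m \<ge> 1\<close> by (cases m) auto
  ultimately show "\<bar>measure_pmf.prob (map_pmf (map (observe (countdown m p))) ?P) S
      - measure_pmf.prob (map_pmf (map (observe (countdown m p))) (state_path (countdown m p) f (m - 1) t)) S\<bar>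
      \<le> real (Suc t) * p ^ (m - 1)"
    by linarith
qed

subsection \<open>Query complexities\<close>

lemma QC_le:
  "tv_dist (observations M A a T) (observations M A b T) \<ge> 1 / 3 \<Longrightarrow> QC M A a b \<le> enat T"
  unfolding QC_def by (intro INF_lower) simp

lemma le_QC:
  assumes "\<And>T. tv_dist (observations M A a T) (observations M A b T) \<ge> 1 / 3 \<Longrightarrow> B \<le> enat T"
  shows "B \<le> QC M A a b"
  unfolding QC_def using assms by (intro INF_greatest) simp

lemma AQC_countdown_le:
  assumes "k \<ge> 1" "m \<ge> 2"
  shows "AQC (countdown m (1 / real k)) m (m - 1) \<le> enat (2 * m * k)"
  unfolding AQC_def
  by (rule INF_lower2[OF UNIV_I, where i = "return_pmf trailing_zeros"])
     (rule QC_le[OF tv_dist_trailing_zeros_ge[OF assms]])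

text \<open>This forces the adaptive complexity to grow with \<open>k\<close>, so that infinitely
  many values occur for a fixed number of states.\<close>

lemma le_AQC_countdown:
  assumes "k \<ge> 1" "m \<ge> 2"
  shows "enat (k div 3) \<le> AQC (countdown m (1 / real k)) m (m - 1)"
  unfolding AQC_def
proof (intro INF_greatest le_QC)
  fix A T
  let ?M = "countdown m (1 / real k)"
  assume "1 / 3 \<le> tv_dist (observations ?M A m T) (observations ?M A (m - 1) T)"
  also have "\<dots> \<le> real T * (1 / real k)"
    using assms by (intro tv_dist_countdown_le) auto
  finally have "real k \<le> real (3 * T)" using assms by (simp add: field_simps)
  then have "k \<le> 3 * T" by (simp only: of_nat_le_iff)
  then show "enat (k div 3) \<le> enat T" by simp
qed

lemma le_NAQC_countdown:
  assumes "k \<ge> 6" "m \<ge> 2"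
  shows "ereal (real k ^ (m - 1) / 6) \<le> ereal_of_enat (NAQC (countdown m (1 / real k)) m (m - 1))"
proof -
  let ?M = "countdown m (1 / real k)"
  have bound: "real k ^ (m - 1) / 6 \<le> real T"
    if "nonadaptive A" and "1 / 3 \<le> tv_dist (observations ?M A m T) (observations ?M A (m - 1) T)"
    for A T
  proof -
    \<comment> \<open>The loss from \<open>R + 1\<close> to \<open>R\<close> is absorbed because
      \<open>K / 3 - 1 \<ge> K / 6\<close> once \<open>K \<ge> 6\<close>.\<close>
    have arith: "K \<le> 3 * (R + 1) \<Longrightarrow> 6 \<le> K \<Longrightarrow> K / 6 \<le> R" for K R :: real
      by simp
    note that(2)
    also have "tv_dist (observations ?M A m T) (observations ?M A (m - 1) T)
        \<le> real (Suc T) * (1 / real k) ^ (m - 1)"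
      using assms that(1) by (intro tv_dist_nonadaptive_le) auto
    finally have "1 / 3 \<le> (real T + 1) / real k ^ (m - 1)"
      by (simp add: power_one_over add.commute)
    then have "real k ^ (m - 1) \<le> 3 * (real T + 1)"
      using assms by (simp add: pos_le_divide_eq)
    moreover have "real k ^ 1 \<le> real k ^ (m - 1)"
      using assms by (intro power_increasing) auto
    then have "6 \<le> real k ^ (m - 1)"
      by (rule order_trans[rotated]) (use assms in simp)
    ultimately show ?thesis by (rule arith)
  qed
  have "enat (nat \<lceil>real k ^ (m - 1) / 6\<rceil>) \<le> NAQC ?M m (m - 1)"
    unfolding NAQC_def
  proof (intro INF_greatest le_QC)
    fix A T assume "A \<in> {A. nonadaptive A}"
      and "1 / 3 \<le> tv_dist (observations ?M A m T) (observations ?M A (m - 1) T)"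
    then have "real k ^ (m - 1) / 6 \<le> real T" using bound by blast
    then show "enat (nat \<lceil>real k ^ (m - 1) / 6\<rceil>) \<le> enat T"
      by (simp add: ceiling_le_iff nat_le_iff)
  qed
  then have "ereal_of_enat (enat (nat \<lceil>real k ^ (m - 1) / 6\<rceil>)) \<le> ereal_of_enat (NAQC ?M m (m - 1))"
    by (simp only: ereal_of_enat_le_iff)
  moreover have "ereal (real k ^ (m - 1) / 6) \<le> ereal_of_enat (enat (nat \<lceil>real k ^ (m - 1) / 6\<rceil>))"
    using real_nat_ceiling_ge[of "real k ^ (m - 1) / 6"] by simp
  ultimately show ?thesis by (rule order_trans[rotated])
qed

theorem theorem1p2:
  shows "\<exists>(c :: nat \<Rightarrow> real) (\<epsilon> :: nat \<Rightarrow> real).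
    (\<forall>n. c n > 0) \<and> \<epsilon> \<longlonglongrightarrow> 0 \<and>
    infinite {n. infinite {q :: nat.
      \<exists>(M :: (nat, nat) po_chain) a b.
        po_markov_chain M \<and> card (states M) = n \<and> a \<in> states M \<and> b \<in> states M \<and>
        AQC M a b = enat q \<and>
        ereal_of_enat (NAQC M a b) \<ge> ereal (c n * real q powr ((1 - \<epsilon> n) * real n))}}"
proof -
  \<comment> \<open>From \<open>q \<le> 2 * m * k \<le> (2 * n + 1) * k\<close> follows
    \<open>k ^ (n - 2) \<ge> (q / (2 * n + 1)) ^ (n - 2)\<close>; the 6 comes from the non-adaptive
    bound. The \<open>+ 1\<close> keeps the base positive for every \<open>n\<close>.\<close>
  define c :: "nat \<Rightarrow> real" where "c n = 1 / (6 * (2 * real n + 1) ^ (n - 2))" for n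
  \<comment> \<open>This makes the exponent \<open>(1 - \<epsilon> n) * n\<close> equal to
    \<open>n - 2 = m - 1\<close>, the number of successes from \<open>m\<close> down to 1.\<close>
  define \<epsilon> :: "nat \<Rightarrow> real" where "\<epsilon> n = 2 / real n" for n
  let ?Q = "\<lambda>n. {q :: nat. \<exists>(M :: (nat, nat) po_chain) a b.
        po_markov_chain M \<and> card (states M) = n \<and> a \<in> states M \<and> b \<in> states M \<and>
        AQC M a b = enat q \<and>
        ereal_of_enat (NAQC M a b) \<ge> ereal (c n * real q powr ((1 - \<epsilon> n) * real n))}"
  have "infinite (?Q n)" if n: "n \<ge> 3" for n
    unfolding infinite_nat_iff_unbounded
  proof
    fix B :: nat
    define m where "m = n - 1"
    \<comment> \<open>Then \<open>k div 3 = B + 6\<close> is a lower bound for \<open>q\<close>, so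
      \<open>q > B\<close>, and \<open>k \<ge> 6\<close> as the non-adaptive bound requires.\<close>
    define k where "k = 3 * (B + 6)"
    let ?M = "countdown m (1 / real k)"
    have m: "m \<ge> 2" "n = Suc m" and k: "k \<ge> 6" using n by (auto simp: m_def k_def)
    obtain q where q: "AQC ?M m (m - 1) = enat q"
      using AQC_countdown_le[of k m] m k by (metis enat_ile le_trans one_le_numeral)
    have "q \<le> 2 * m * k" and qB: "B + 6 \<le> q"
      using AQC_countdown_le[of k m] le_AQC_countdown[of k m] m k unfolding q by (auto simp: k_def)
    then have "real q \<le> real (2 * m * k)" by (simp only: of_nat_le_iff)
    then have "real q \<le> 2 * real m * real k" by simp
    also have "\<dots> \<le> (2 * real n + 1) * real k"
      using m by (intro mult_right_mono) auto
    finally have "real q ^ (m - 1) \<le> ((2 * real n + 1) * real k) ^ (m - 1)"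
      by (intro power_mono) auto
    moreover have "(1 - \<epsilon> n) * real n = real (m - 1)"
      using m by (simp add: \<epsilon>_def field_simps of_nat_diff)
    then have "real q powr ((1 - \<epsilon> n) * real n) = real q ^ (m - 1)"
      using qB by (simp add: powr_realpow)
    moreover have "n - 2 = m - 1" using m by simp
    ultimately have "c n * real q powr ((1 - \<epsilon> n) * real n) \<le> real k ^ (m - 1) / 6"
      by (simp add: c_def power_mult_distrib divide_simps mult.commute)
    then have "ereal (c n * real q powr ((1 - \<epsilon> n) * real n)) \<le> ereal_of_enat (NAQC ?M m (m - 1))"
      using le_NAQC_countdown[OF k m(1)] by (meson ereal_less_eq(3) order_trans)
    moreover have "card (states ?M) = n" "m \<in> states ?M" "m - 1 \<in> states ?M"
      using m by simp_all
    ultimately have "q \<in> ?Q n"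
      unfolding mem_Collect_eq using q po_markov_chain_countdown by blast
    moreover have "B < q" using qB by simp
    ultimately show "\<exists>q>B. q \<in> ?Q n" by (rule exI[of _ q, OF conjI, rotated])
  qed
  then have "{3..} \<subseteq> {n. infinite (?Q n)}" by auto
  then have "infinite {n. infinite (?Q n)}"
    using infinite_Ici[of "3 :: nat"] infinite_super by blast
  moreover have "\<epsilon> \<longlonglongrightarrow> 0" unfolding \<epsilon>_def by (rule lim_const_over_n)
  moreover have "c n > 0" for n by (simp add: c_def add_nonneg_pos)
  ultimately show ?thesis by blast
qed

end
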